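(* Let $\mathbb{X}$ be a compact subset of a Polish space, $\mathbb{U}$ a finite set, $\beta\in(0,1)$, and let $\{X_t\}$ be a controlled Markov chain on $\mathbb{X}$ with transition kernel $\mathcal{T}(\cdot|x,u)$ and control actions $U_t\in\mathbb{U}$ generated by an exploration policy $\gamma$. Let $c:\mathbb{X}\times\mathbb{U}\to\mathbb{R}_+$ be continuous and bounded. Let $\{B_i\}_{i=1}^M$ be disjoint measurable sets with $\bigcup_{i=1}^M B_i=\mathbb{X}$, let $\mathbb{S}=\{y_1,\dots,y_M\}$ be a finite set, and define the quantizer $g:\mathbb{X}\to\mathbb{S}$ by $g(x)=y_i$ if $x\in B_i$. Put $S_t=g(X_t)$ and $C_t=c(X_t,U_t)$. Assume that, under the exploration policy $\gamma$ and the given initialization, there is a probability measure $\pi^\gamma$ on $\mathbb{X}\times\mathbb{U}$ such that for every measurable, $\pi^\gamma$-integrable function $f:\mathbb{X}\times\mathbb{U}\to\mathbb{R}$, almost surely, $$\lim_{N\to\infty}\frac1N\sum_{t=0}^{N-1}f(X_t,U_t)=\int f(x,u)\,\pi^\gamma(dx,du),$$ and such that $\pi^\gamma(B_i\times\{u\})>0$ for every $i\in\{1,\dots,M\}$ and every $u\in\mathbb{U}$. Assume also that the learning rates satisfy: $\alpha_t(s,u)=0$ unless $(S_t,U_t)=(s,u)$; when $(S_t,U_t)=(s,u)$, $\alpha_t(s,u)=\bigl(1+\sum_{k=0}^t1_{\{S_k=s,U_k=u\}}\bigr)^{-1}$; and with probability $1$, $\sum_t\alpha_t(s,u)=\infty$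 for all $(s,u)\in\mathbb{S}\times\mathbb{U}$. Then the iterations $$Q_{t+1}(s,u)=(1-\alpha_t(s,u))Q_t(s,u)+\alpha_t(s,u)\Bigl(C_t+\beta \min_{u'\in\mathbb{U}}Q_t(S_{t+1},u')\Bigr),\qquad (s,u)\in\mathbb{S}\times\mathbb{U},$$ started from any $Q_0:\mathbb{S}\times\mathbb{U}\to\mathbb{R}$, converge almost surely, i.e. for each $(s,u)$, $Q_t(s,u)$ converges almost surely to a finite limit as $t\to\infty$.
   Context: Controlled Markov chain: for all Borel $B$ and $t\ge0$, $P(X_{t+1}\in B\mid X_0,\dots,X_t,U_0,\dots,U_t)=\mathcal{T}(B|X_t,U_t)$, where $\mathcal{T}$ is a stochastic kernel from $\mathbb{X}\times\mathbb{U}$ to $\mathbb{X}$. The exploration policy $\gamma$ is a (possibly randomized) non-anticipative rule for choosing $U_t$ from the information available at time $t$. $1_{\{\cdot\}}$ denotes an indicator function. *)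

theory Defs
  imports "HOL-Probability.Probability"
begin

definition history ::
  "(nat \<Rightarrow> 'w \<Rightarrow> 'x) \<Rightarrow> (nat \<Rightarrow> 'w \<Rightarrow> 'u) \<Rightarrow> nat \<Rightarrow> nat \<Rightarrow> 'w \<Rightarrow> (nat \<Rightarrow> 'x) \<times> (nat \<Rightarrow> 'u)"
  where "history Xs Us m n \<omega> = ((\<lambda>k\<in>{..<m}. Xs k \<omega>), (\<lambda>k\<in>{..<n}. Us k \<omega>))"

definition history_space ::
  "'x measure \<Rightarrow> 'u measure \<Rightarrow> nat \<Rightarrow> nat \<Rightarrow> ((nat \<Rightarrow> 'x) \<times> (nat \<Rightarrow> 'u)) measure"
  where "history_space MX MU m n = PiM {..<m} (\<lambda>_. MX) \<Otimes>\<^sub>M PiM {..<n} (\<lambda>_. MU)"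

text \<open>The sub-sigma-algebra generated by \<open>X\<^sub>0, \<dots>, X\<^sub>m\<^sub>-\<^sub>1, U\<^sub>0, \<dots>, U\<^sub>n\<^sub>-\<^sub>1\<close>.\<close>

definition history_algebra ::
  "'w measure \<Rightarrow> 'x measure \<Rightarrow> 'u measure \<Rightarrow> (nat \<Rightarrow> 'w \<Rightarrow> 'x) \<Rightarrow> (nat \<Rightarrow> 'w \<Rightarrow> 'u) \<Rightarrow>
    nat \<Rightarrow> nat \<Rightarrow> 'w measure"
  where "history_algebra P MX MU Xs Us m n =
    vimage_algebra (space P) (history Xs Us m n) (history_space MX MU m n)"

text \<open>A randomized non-anticipative policy: at time \<open>t\<close> a stochastic kernel maps the information
  \<open>(X\<^sub>0, \<dots>, X\<^sub>t, U\<^sub>0, \<dots>, U\<^sub>t\<^sub>-\<^sub>1)\<close> to a distribution over actions.\<close>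

definition randomized_policy ::
  "'x measure \<Rightarrow> 'u measure \<Rightarrow> (nat \<Rightarrow> (nat \<Rightarrow> 'x) \<times> (nat \<Rightarrow> 'u) \<Rightarrow> 'u measure) \<Rightarrow> bool"
  where "randomized_policy MX MU \<gamma> \<longleftrightarrow>
    (\<forall>t. \<gamma> t \<in> history_space MX MU (Suc t) t \<rightarrow>\<^sub>M prob_algebra MU)"

text \<open>Conditional probabilities given a sigma-algebra are conditional expectations of indicators.
  The law of \<open>X\<^sub>0\<close> is left unconstrained: the initialization is part of \<open>P\<close>.\<close>

definition controlled_markov_chain ::
  "'w measure \<Rightarrow> 'x measure \<Rightarrow> 'u measure \<Rightarrow> ('x \<times> 'u \<Rightarrow> 'x measure) \<Rightarrow>
    (nat \<Rightarrow> (nat \<Rightarrow> 'x) \<times> (nat \<Rightarrow> 'u) \<Rightarrow> 'u measure) \<Rightarrow>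
    (nat \<Rightarrow> 'w \<Rightarrow> 'x) \<Rightarrow> (nat \<Rightarrow> 'w \<Rightarrow> 'u) \<Rightarrow> bool"
  where "controlled_markov_chain P MX MU \<T> \<gamma> Xs Us \<longleftrightarrow>
    prob_space P \<and>
    \<T> \<in> MX \<Otimes>\<^sub>M MU \<rightarrow>\<^sub>M prob_algebra MX \<and>
    randomized_policy MX MU \<gamma> \<and>
    (\<forall>t. Xs t \<in> P \<rightarrow>\<^sub>M MX) \<and> (\<forall>t. Us t \<in> P \<rightarrow>\<^sub>M MU) \<and>
    (\<forall>t. \<forall>A\<in>sets MU. AE \<omega> in P.
      real_cond_exp P (history_algebra P MX MU Xs Us (Suc t) t)
        (indicator (Us t -` A \<inter> space P)) \<omega>
      = measure (\<gamma> t (history Xs Us (Suc t) t \<omega>)) A) \<and>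
    (\<forall>t. \<forall>B\<in>sets MX. AE \<omega> in P.
      real_cond_exp P (history_algebra P MX MU Xs Us (Suc t) (Suc t))
        (indicator (Xs (Suc t) -` B \<inter> space P)) \<omega>
      = measure (\<T> (Xs t \<omega>, Us t \<omega>)) B)"

text \<open>The Q-learning recursion along a single sample path with learning rates \<open>a\<close>, quantized
  states \<open>S\<close> and costs \<open>C\<close>; the actions enter only through \<open>a\<close> and \<open>C\<close>.\<close>

primrec q_iter ::
  "real \<Rightarrow> 'u set \<Rightarrow> (nat \<Rightarrow> 's \<Rightarrow> 'u \<Rightarrow> real) \<Rightarrow> (nat \<Rightarrow> 's) \<Rightarrow> (nat \<Rightarrow> real) \<Rightarrow>
    ('s \<Rightarrow> 'u \<Rightarrow> real) \<Rightarrow> nat \<Rightarrow> 's \<Rightarrow> 'u \<Rightarrow> real"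
  where
    "q_iter \<beta> \<U> a S C Q0 0 = Q0"
  | "q_iter \<beta> \<U> a S C Q0 (Suc t) = (\<lambda>s u.
      (1 - a t s u) * q_iter \<beta> \<U> a S C Q0 t s u
      + a t s u * (C t + \<beta> * (MIN u'\<in>\<U>. q_iter \<beta> \<U> a S C Q0 t (S (Suc t)) u')))"

end

theory Submission
  imports Defs "HOL-Library.Discrete_Functions"
begin

text \<open>The quantized process \<open>S\<^sub>t = g X\<^sub>t\<close> need not be Markov, yet Q-learning converges because everything
  the iteration sees has long-run averages. On its \<open>n\<close>-th visit a pair \<open>(s, u)\<close> is updated with
  rate \<open>1 / (1 + n)\<close>, so \<open>Q\<^sub>t s u\<close> is literally the average of the starting value and of all the targets
  \<open>C\<^sub>k + \<beta> V\<^sub>k (S\<^sub>k\<^sub>+\<^sub>1)\<close>, \<open>V\<^sub>k s = min\<^sub>u Q\<^sub>k s u\<close>, met at the visits \<open>k < t\<close>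
  (\<open>q_iter_eq_average\<close>).

  Ergodicity gives, almost surely, a positive limiting frequency \<open>p s u\<close> of visits and a limiting
  average cost \<open>q s u / p s u\<close> per visit. It does not directly speak about the pairs
  \<open>(X\<^sub>k, X\<^sub>k\<^sub>+\<^sub>1)\<close> that determine the frequencies of transitions \<open>(s, u) \<rightarrow> s'\<close>. But the
  difference between the indicator of \<open>S\<^sub>k\<^sub>+\<^sub>1 = s'\<close> and its conditional probability, a function of
  \<open>(X\<^sub>k, U\<^sub>k)\<close>, is a bounded martingale difference, and averages of those vanish almost surely
  (\<open>controlled_markov_chain_transition_averages\<close>); hence transition frequencies \<open>r s u s'\<close> exist too.

  The limits define a finite Markov decision problem with transition probabilities
  \<open>r s u s' / p s u\<close> and costs \<open>q s u / p s u\<close>; let \<open>Q\<^sup>*\<close> solve its optimality equation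
  (\<open>bellman_fixed_point_exists\<close>). If \<open>V\<^sub>k\<close> is replaced by \<open>V\<^sup>*\<close> in the targets, their averages
  converge to \<open>Q\<^sup>*\<close>, exactly by the optimality equation. The replacement costs at most \<open>\<beta>\<close> times an
  average of the past errors \<open>max \<bar>Q\<^sub>k - Q\<^sup>*\<bar>\<close>. So the limit superior of the error is at most \<open>\<beta>\<close> times
  itself, hence zero (\<open>discounted_average_errors_tendsto_zero\<close>). This last part is a statement about
  a single sample path (\<open>q_iter_convergent\<close>).\<close>

section \<open>The optimality equation of a finite model\<close>

lemma abs_MIN_diff_le:
  fixes f g :: "'u \<Rightarrow> real"
  assumes "finite U" "U \<noteq> {}" and le: "\<And>u. u \<in> U \<Longrightarrow> \<bar>f u - g u\<bar> \<le> d"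
  shows "\<bar>(MIN u\<in>U. f u) - (MIN u\<in>U. g u)\<bar> \<le> d"
proof -
  have "(MIN u\<in>U. f u) \<in> f ` U" "(MIN u\<in>U. g u) \<in> g ` U"
    using assms by (auto intro!: Min_in)
  then obtain v w where v: "v \<in> U" "(MIN u\<in>U. f u) = f v" and w: "w \<in> U" "(MIN u\<in>U. g u) = g w"
    by auto
  have "f v \<le> f w" "g w \<le> g v"
    using v w assms by (metis Min_le finite_imageI imageI)+
  with le[OF v(1)] le[OF w(1)] v w show ?thesis by auto
qed

lemma tendsto_MIN:
  fixes f :: "'a \<Rightarrow> 'u \<Rightarrow> real"
  assumes "finite U" "U \<noteq> {}" and "\<And>u. u \<in> U \<Longrightarrow> ((\<lambda>n. f n u) \<longlongrightarrow> l u) F"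
  shows "((\<lambda>n. MIN u\<in>U. f n u) \<longlongrightarrow> (MIN u\<in>U. l u)) F"
  using assms
proof (induction U rule: finite_ne_induct)
  case (insert x U)
  then have "((\<lambda>n. min (f n x) (MIN u\<in>U. f n u)) \<longlongrightarrow> min (l x) (MIN u\<in>U. l u)) F"
    by (intro tendsto_min) auto
  with insert show ?case by simp
qed simp

text \<open>The Bellman operator is a \<open>\<beta>\<close>-contraction for the maximum norm over \<open>S \<times> U\<close>, because weights
  summing to one average the differences of the minima. The solution is the limit of its iterates
  from zero; working with iterates avoids a metric on functions that matter only on \<open>S \<times> U\<close>.\<close>

lemma bellman_fixed_point_exists:
  fixes C :: "'s \<Rightarrow> 'u \<Rightarrow> real" and w :: "'s \<Rightarrow> 'u \<Rightarrow> 's \<Rightarrow> real"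
  assumes finU: "finite U" "U \<noteq> {}" and \<beta>: "0 \<le> \<beta>" "\<beta> < 1"
    and finS: "finite S"
    and w_nonneg: "\<And>s u s'. s \<in> S \<Longrightarrow> u \<in> U \<Longrightarrow> s' \<in> S \<Longrightarrow> 0 \<le> w s u s'"
    and w_sum: "\<And>s u. s \<in> S \<Longrightarrow> u \<in> U \<Longrightarrow> (\<Sum>s'\<in>S. w s u s') = 1"
  obtains Q where "\<And>s u. s \<in> S \<Longrightarrow> u \<in> U \<Longrightarrow>
    Q s u = C s u + \<beta> * (\<Sum>s'\<in>S. w s u s' * (MIN u'\<in>U. Q s' u'))"
proof -
  define F where "F Q s u = C s u + \<beta> * (\<Sum>s'\<in>S. w s u s' * (MIN u'\<in>U. Q s' u'))" for Q s u
  have contraction: "\<bar>F Q s u - F Q' s u\<bar> \<le> \<beta> * d"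
    if le: "\<And>s u. s \<in> S \<Longrightarrow> u \<in> U \<Longrightarrow> \<bar>Q s u - Q' s u\<bar> \<le> d" and su: "s \<in> S" "u \<in> U" for Q Q' d s u
  proof -
    have "F Q s u - F Q' s u
        = \<beta> * (\<Sum>s'\<in>S. w s u s' * ((MIN u'\<in>U. Q s' u') - (MIN u'\<in>U. Q' s' u')))"
      by (simp add: F_def right_diff_distrib sum_subtractf)
    also have "\<bar>\<dots>\<bar> = \<beta> * \<bar>\<Sum>s'\<in>S. w s u s' * ((MIN u'\<in>U. Q s' u') - (MIN u'\<in>U. Q' s' u'))\<bar>"
      using \<beta> by (simp add: abs_mult)
    also have "\<dots> \<le> \<beta> * (\<Sum>s'\<in>S. w s u s' * d)"
    proof (intro mult_left_mono order_trans[OF sum_abs] sum_mono)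
      fix s' assume "s' \<in> S"
      then show "\<bar>w s u s' * ((MIN u'\<in>U. Q s' u') - (MIN u'\<in>U. Q' s' u'))\<bar> \<le> w s u s' * d"
        using w_nonneg[OF su] abs_MIN_diff_le[OF finU, of "Q s'" "Q' s'" d] le
        by (auto simp: abs_mult intro!: mult_left_mono)
    qed (use \<beta> in auto)
    also have "\<dots> = \<beta> * d"
      using w_sum[OF su] by (simp flip: sum_distrib_right)
    finally show ?thesis .
  qed
  define q where "q n = (F ^^ n) (\<lambda>_ _. 0)" for n
  have q_Suc: "q (Suc n) = F (q n)" for n by (simp add: q_def)
  define d where "d = (\<Sum>s\<in>S. \<Sum>u\<in>U. \<bar>q 1 s u - q 0 s u\<bar>)"
  have step: "\<bar>q (Suc n) s u - q n s u\<bar> \<le> \<beta> ^ n * d" if "s \<in> S" "u \<in> U" for n s u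
    using that
  proof (induction n arbitrary: s u)
    case 0
    have "\<bar>q 1 s u - q 0 s u\<bar> \<le> (\<Sum>u\<in>U. \<bar>q 1 s u - q 0 s u\<bar>)"
      using 0 finU by (intro member_le_sum) auto
    also have "\<dots> \<le> d"
      unfolding d_def using 0 finS by (intro member_le_sum[where f = "\<lambda>s. \<Sum>u\<in>U. \<bar>q 1 s u - q 0 s u\<bar>"]) (auto intro: sum_nonneg)
    finally show ?case by simp
  next
    case (Suc n)
    then show ?case using contraction[of "q (Suc n)" "q n" "\<beta> ^ n * d" s u]
      by (simp add: q_Suc)
  qed
  define Q where "Q s u = lim (\<lambda>n. q n s u)" for s u
  have q_lim: "(\<lambda>n. q n s u) \<longlonglongrightarrow> Q s u" if su: "s \<in> S" "u \<in> U" for s u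
  proof -
    have "summable (\<lambda>n. q (Suc n) s u - q n s u)"
    proof (rule summable_comparison_test')
      show "summable (\<lambda>n. \<beta> ^ n * d)"
        using \<beta> by (intro summable_mult2 summable_geometric) auto
      show "norm (q (Suc n) s u - q n s u) \<le> \<beta> ^ n * d" if "n \<ge> 0" for n
        using step[OF su] by simp
    qed
    then have "convergent (\<lambda>n. \<Sum>k<n. q (Suc k) s u - q k s u)"
      by (simp add: summable_iff_convergent)
    then have "convergent (\<lambda>n. q n s u - q 0 s u)"
      using sum_lessThan_telescope[of "\<lambda>n. q n s u"] by simp
    then show ?thesis
      unfolding Q_def by (simp add: convergent_diff_const_right_iff convergent_LIMSEQ_iff)
  qed
  have "Q s u = F Q s u" if su: "s \<in> S" "u \<in> U" for s u
  proof (rule LIMSEQ_unique)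
    show "(\<lambda>n. q (Suc n) s u) \<longlonglongrightarrow> Q s u"
      using q_lim[OF su] by (rule LIMSEQ_Suc)
    show "(\<lambda>n. q (Suc n) s u) \<longlonglongrightarrow> F Q s u"
      unfolding q_Suc F_def
      by (intro tendsto_intros tendsto_MIN finU q_lim)
  qed
  then show thesis
    using that[of Q] by (simp add: F_def)
qed

section \<open>Errors controlled by discounted averages of past errors\<close>

text \<open>Suppose the maximal error is eventually at most \<open>L\<close>. In its weighted average the early errors
  become negligible since the total weight diverges, so the average is eventually at most slightly more
  than \<open>L\<close>, and the next bound is \<open>\<theta> L\<close> for any \<open>\<theta>\<close> between \<open>\<beta>\<close> and \<open>1\<close>. Starting from some
  uniform bound this can be repeated indefinitely. The weights play the role of visit indicators; the
  extra \<open>1\<close> in the denominator is the weight of the initial value.\<close>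

lemma discounted_average_errors_tendsto_zero:
  fixes e \<rho> v :: "nat \<Rightarrow> 'z \<Rightarrow> real"
  assumes fin: "finite Z" and \<beta>: "0 \<le> \<beta>" "\<beta> < 1"
    and v: "\<And>k z. z \<in> Z \<Longrightarrow> 0 \<le> v k z"
    and v_sum: "\<And>z. z \<in> Z \<Longrightarrow> filterlim (\<lambda>t. \<Sum>k<t. v k z) at_top sequentially"
    and \<rho>: "\<And>z. z \<in> Z \<Longrightarrow> (\<lambda>t. \<rho> t z) \<longlonglongrightarrow> 0"
    and bound: "\<And>t z. z \<in> Z \<Longrightarrow>
      \<bar>e t z\<bar> \<le> \<rho> t z + \<beta> * (\<Sum>k<t. v k z * (MAX z\<in>Z. \<bar>e k z\<bar>)) / (1 + (\<Sum>k<t. v k z))"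
    and z: "z \<in> Z"
  shows "(\<lambda>t. e t z) \<longlonglongrightarrow> 0"
proof -
  define E where "E k = (MAX z\<in>Z. \<bar>e k z\<bar>)" for k
  define n where "n t z = (\<Sum>k<t. v k z)" for t z
  have n_nonneg: "0 \<le> n t z" if "z \<in> Z" for t z
    unfolding n_def using v that by (intro sum_nonneg) auto
  have Z_ne: "Z \<noteq> {}" using z by auto
  have E_ge: "\<bar>e k z\<bar> \<le> E k" if "z \<in> Z" for k z
    unfolding E_def using fin that by (intro Max_ge) auto
  have E_leI: "E k \<le> x" if "\<And>z. z \<in> Z \<Longrightarrow> \<bar>e k z\<bar> \<le> x" for k x
    unfolding E_def using fin Z_ne that by (subst Max_le_iff) auto
  have E_nonneg: "0 \<le> E k" for k
    using E_ge[OF z, of k] by linarith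
  have bound': "\<bar>e t z\<bar> \<le> \<rho> t z + \<beta> * (\<Sum>k<t. v k z * E k) / (1 + n t z)" if "z \<in> Z" for t z
    using bound[OF that] by (simp add: E_def n_def)

  obtain R where R: "0 < R" "\<And>t z. z \<in> Z \<Longrightarrow> \<rho> t z \<le> R"
  proof -
    have "\<exists>K. \<forall>t. norm (\<rho> t z) \<le> K" if "z \<in> Z" for z
      using convergent_imp_Bseq[OF convergentI[OF \<rho>[OF that]]] by (auto simp: Bseq_def)
    then obtain K where K: "\<And>t z. z \<in> Z \<Longrightarrow> norm (\<rho> t z) \<le> K z" by metis
    have "\<rho> t z \<le> 1 + (\<Sum>z\<in>Z. \<bar>K z\<bar>)" if "z \<in> Z" for t z
      using K[OF that, of t] member_le_sum[of z Z "\<lambda>z. \<bar>K z\<bar>"] fin that by auto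
    then show thesis
      by (intro that[of "1 + (\<Sum>z\<in>Z. \<bar>K z\<bar>)"]) (auto intro!: add_pos_nonneg sum_nonneg)
  qed
  \<comment> \<open>The fixed point of \<open>x \<mapsto> R + \<beta> x\<close> bounds all errors, by induction over time.\<close>
  define K where "K = R / (1 - \<beta>)"
  have K: "0 < K" "R + \<beta> * K = K"
    using R \<beta> by (auto simp: K_def field_simps)
  have E_le_K: "E t \<le> K" for t
  proof (induction t rule: less_induct)
    case (less t)
    show ?case
    proof (rule E_leI)
      fix z assume z: "z \<in> Z"
      have "(\<Sum>k<t. v k z * E k) \<le> (\<Sum>k<t. v k z * K)"
        using v[OF z] less by (intro sum_mono mult_left_mono) auto
      also have "\<dots> = n t z * K" by (simp add: n_def sum_distrib_right)
      also have "\<dots> \<le> (1 + n t z) * K" using K by simp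
      finally have "(\<Sum>k<t. v k z * E k) / (1 + n t z) \<le> K"
        using n_nonneg[OF z, of t] by (simp add: divide_le_eq mult.commute)
      then have "\<beta> * ((\<Sum>k<t. v k z * E k) / (1 + n t z)) \<le> \<beta> * K"
        using \<beta> by (intro mult_left_mono) auto
      with bound'[OF z, of t] R(2)[OF z, of t] K show "\<bar>e t z\<bar> \<le> K" by simp
    qed
  qed

  define \<theta> where "\<theta> = (1 + \<beta>) / 2"
  have \<theta>: "0 < \<theta>" "\<theta> < 1" "\<beta> < \<theta>" using \<beta> by (auto simp: \<theta>_def)
  have improve: "\<forall>\<^sub>F t in sequentially. E t \<le> \<theta> * L"
    if ev: "\<forall>\<^sub>F t in sequentially. E t \<le> L" and L: "0 < L" for L
  proof -
    obtain T where T: "\<And>k. T \<le> k \<Longrightarrow> E k \<le> L"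
      using ev by (auto simp: eventually_sequentially)
    have "\<forall>\<^sub>F t in sequentially. \<bar>e t z\<bar> \<le> \<theta> * L" if z: "z \<in> Z" for z
    proof -
      define H where "H = (\<Sum>k<T. v k z * E k)"
      have n_lim: "filterlim (\<lambda>t. 1 + n t z) at_top sequentially"
        unfolding n_def by (intro filterlim_tendsto_add_at_top[OF tendsto_const] v_sum z)
      have "(\<lambda>t. \<rho> t z + \<beta> * H / (1 + n t z)) \<longlonglongrightarrow> 0 + 0"
        by (intro tendsto_add \<rho> z tendsto_divide_0[OF tendsto_const]
              filterlim_at_top_imp_at_infinity n_lim)
      moreover have "0 + 0 < (\<theta> - \<beta>) * L" using \<theta> L by simp
      ultimately have "\<forall>\<^sub>F t in sequentially. \<rho> t z + \<beta> * H / (1 + n t z) < (\<theta> - \<beta>) * L"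
        by (rule order_tendstoD)
      then show ?thesis
      proof eventually_elim
        case (elim t)
        \<comment> \<open>Errors before \<open>T\<close> enter with the fixed total \<open>H\<close>; each later one is at most \<open>L\<close>.\<close>
        have "(\<Sum>k<t. v k z * E k) \<le> (\<Sum>k<t. (if k < T then v k z * E k else 0) + v k z * L)"
          using v[OF z] T E_nonneg L by (intro sum_mono) (auto intro!: mult_left_mono)
        also have "\<dots> = (\<Sum>k\<in>{..<t} \<inter> {..<T}. v k z * E k) + n t z * L"
          by (simp add: sum.distrib sum.inter_restrict n_def sum_distrib_right)
        also have "\<dots> \<le> H + (1 + n t z) * L"
          unfolding H_def using v[OF z] E_nonneg L by (intro add_mono sum_mono2) auto
        finally have "(\<Sum>k<t. v k z * E k) / (1 + n t z) \<le> (H + (1 + n t z) * L) / (1 + n t z)"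
          using n_nonneg[OF z, of t] by (intro divide_right_mono) auto
        also have "\<dots> = H / (1 + n t z) + L"
          using n_nonneg[OF z, of t] by (simp add: add_divide_distrib)
        finally have "(\<Sum>k<t. v k z * E k) / (1 + n t z) \<le> H / (1 + n t z) + L" .
        then have "\<beta> * ((\<Sum>k<t. v k z * E k) / (1 + n t z)) \<le> \<beta> * (H / (1 + n t z) + L)"
          using \<beta> by (intro mult_left_mono) auto
        with bound'[OF z, of t] elim show ?case by (simp add: algebra_simps)
      qed
    qed
    then have "\<forall>\<^sub>F t in sequentially. \<forall>z\<in>Z. \<bar>e t z\<bar> \<le> \<theta> * L"
      using fin by (simp add: eventually_ball_finite)
    then show ?thesis
      by eventually_elim (auto intro: E_leI)
  qed
  have E_ev: "\<forall>\<^sub>F t in sequentially. E t \<le> \<theta> ^ m * K" for m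
  proof (induction m)
    case 0
    show ?case using E_le_K by simp
  next
    case (Suc m)
    have "0 < \<theta> ^ m * K" using \<theta> K by simp
    from improve[OF Suc this] show ?case by (simp add: mult.assoc)
  qed
  show ?thesis
  proof (rule tendstoI)
    fix \<epsilon> :: real assume "\<epsilon> > 0"
    have "(\<lambda>m. \<theta> ^ m * K) \<longlonglongrightarrow> 0 * K"
      using \<theta> by (intro tendsto_intros LIMSEQ_realpow_zero) auto
    then have "\<forall>\<^sub>F m in sequentially. \<theta> ^ m * K < \<epsilon>"
      using \<open>\<epsilon> > 0\<close> by (auto dest: order_tendstoD)
    then obtain m where "\<theta> ^ m * K < \<epsilon>"
      by (auto simp: eventually_sequentially)
    with E_ev[of m] show "\<forall>\<^sub>F t in sequentially. dist (e t z) 0 < \<epsilon>"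
      by (elim eventually_mono) (use E_ge[OF z] in \<open>auto intro: le_less_trans order_trans\<close>)
  qed
qed

section \<open>Convergence of quantized Q-learning along one sample path\<close>

text \<open>With \<open>n\<close> earlier visits the current visit has rate \<open>1 / (2 + n)\<close>, so multiplying the update
  by \<open>2 + n\<close> adds exactly the target to \<open>(1 + n) Q\<close>: the product of \<open>Q\<close> with one plus its number of
  visits accumulates the targets, and \<open>Q0\<close> counts as one observation.\<close>

lemma q_iter_eq_average:
  assumes a: "\<And>k. a k s u = (if S k = s \<and> A k = u
      then inverse (1 + (\<Sum>j\<le>k. of_bool (S j = s \<and> A j = u))) else 0)"
  shows "(1 + (\<Sum>k<t. of_bool (S k = s \<and> A k = u))) * q_iter \<beta> U a S C Q0 t s u
    = Q0 s u + (\<Sum>k<t. of_bool (S k = s \<and> A k = u) *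
        (C k + \<beta> * (MIN u'\<in>U. q_iter \<beta> U a S C Q0 k (S (Suc k)) u')))"
proof (induction t)
  case (Suc t)
  define n :: real where "n = (\<Sum>k<t. of_bool (S k = s \<and> A k = u))"
  define x where "x = q_iter \<beta> U a S C Q0 t s u"
  define y where "y = C t + \<beta> * (MIN u'\<in>U. q_iter \<beta> U a S C Q0 t (S (Suc t)) u')"
  have n: "0 \<le> n" unfolding n_def by (intro sum_nonneg) auto
  have sum_t: "(\<Sum>j\<le>t. of_bool (S j = s \<and> A j = u)) = n + of_bool (S t = s \<and> A t = u)"
    by (simp add: n_def flip: lessThan_Suc_atMost)
  show ?case
  proof (cases "S t = s \<and> A t = u")
    case True
    have "(1 + (n + 1)) * ((1 - inverse (1 + (n + 1))) * x + inverse (1 + (n + 1)) * y) = (1 + n) * x + y"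
      using n by (simp add: divide_simps)
    with True Suc show ?thesis
      by (simp add: a[of t] sum_t flip: n_def x_def y_def)
  next
    case False
    then have "a t s u = 0" and not_visited: "\<not> (S t = s \<and> A t = u)"
      by (simp_all add: a[of t])
    with Suc show ?thesis
      unfolding sum.lessThan_Suc of_bool_eq_0_iff[THEN iffD2, OF not_visited] by simp
  qed
qed simp

text \<open>No probability is left here: \<open>p\<close>, \<open>q\<close> and \<open>r\<close> are the averages per unit time of visits, costs
  and transitions along the path. The error splits into the average that the targets would have with
  the optimal value function \<open>V\<close> (the noise, which vanishes by the optimality equation) and a
  discounted average of earlier errors.\<close>

lemma q_iter_convergent:
  fixes S :: "nat \<Rightarrow> 's" and A :: "nat \<Rightarrow> 'u" and C :: "nat \<Rightarrow> real"
    and p q :: "'s \<Rightarrow> 'u \<Rightarrow> real" and r :: "'s \<Rightarrow> 'u \<Rightarrow> 's \<Rightarrow> real"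
  assumes finS: "finite \<S>" and finU: "finite U" and \<beta>: "0 \<le> \<beta>" "\<beta> < 1"
    and S: "\<And>t. S t \<in> \<S>"
    and a: "\<And>s u k. s \<in> \<S> \<Longrightarrow> u \<in> U \<Longrightarrow> a k s u = (if S k = s \<and> A k = u
      then inverse (1 + (\<Sum>j\<le>k. of_bool (S j = s \<and> A j = u))) else 0)"
    and visits: "\<And>s u. s \<in> \<S> \<Longrightarrow> u \<in> U \<Longrightarrow>
      (\<lambda>t. (\<Sum>k<t. of_bool (S k = s \<and> A k = u)) / real t) \<longlonglongrightarrow> p s u"
    and p_pos: "\<And>s u. s \<in> \<S> \<Longrightarrow> u \<in> U \<Longrightarrow> 0 < p s u"
    and costs: "\<And>s u. s \<in> \<S> \<Longrightarrow> u \<in> U \<Longrightarrow>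
      (\<lambda>t. (\<Sum>k<t. of_bool (S k = s \<and> A k = u) * C k) / real t) \<longlonglongrightarrow> q s u"
    and transitions: "\<And>s u s'. s \<in> \<S> \<Longrightarrow> u \<in> U \<Longrightarrow> s' \<in> \<S> \<Longrightarrow>
      (\<lambda>t. (\<Sum>k<t. of_bool (S k = s \<and> A k = u) * of_bool (S (Suc k) = s')) / real t) \<longlonglongrightarrow> r s u s'"
    and su: "s \<in> \<S>" "u \<in> U"
  shows "convergent (\<lambda>t. q_iter \<beta> U a S C Q0 t s u)"
proof -
  define v :: "nat \<Rightarrow> 's \<times> 'u \<Rightarrow> real" where "v k z = of_bool (S k = fst z \<and> A k = snd z)" for k z
  have U_ne: "U \<noteq> {}" using su by auto
  have r_nonneg: "0 \<le> r s u s'" if "s \<in> \<S>" "u \<in> U" "s' \<in> \<S>" for s u s'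
    by (rule LIMSEQ_le_const[OF transitions[OF that]]) (auto intro!: exI divide_nonneg_nonneg sum_nonneg)
  have r_sum: "(\<Sum>s'\<in>\<S>. r s u s') = p s u" if "s \<in> \<S>" "u \<in> U" for s u
  proof (rule LIMSEQ_unique[OF _ visits[OF that]])
    have eq: "(\<Sum>s'\<in>\<S>. of_bool (S (Suc k) = s')) = (1 :: real)" for k
      using sum.delta'[OF finS, of "S (Suc k)" "\<lambda>_. 1 :: real"] S by (simp add: of_bool_def)
    have "(\<lambda>t. \<Sum>s'\<in>\<S>. (\<Sum>k<t. of_bool (S k = s \<and> A k = u) * of_bool (S (Suc k) = s')) / real t)
        \<longlonglongrightarrow> (\<Sum>s'\<in>\<S>. r s u s')"
      by (intro tendsto_sum transitions that)
    also have "(\<lambda>t. \<Sum>s'\<in>\<S>. (\<Sum>k<t. of_bool (S k = s \<and> A k = u) * of_bool (S (Suc k) = s')) / real t)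
        = (\<lambda>t. (\<Sum>k<t. of_bool (S k = s \<and> A k = u) * (\<Sum>s'\<in>\<S>. of_bool (S (Suc k) = s'))) / real t)"
      by (subst sum_divide_distrib[symmetric], subst sum.swap, simp only: sum_distrib_left)
    finally show "(\<lambda>t. (\<Sum>k<t. of_bool (S k = s \<and> A k = u)) / real t) \<longlonglongrightarrow> (\<Sum>s'\<in>\<S>. r s u s')"
      by (simp only: eq mult_1_right)
  qed
  obtain Qs where Qs: "\<And>s u. s \<in> \<S> \<Longrightarrow> u \<in> U \<Longrightarrow>
      Qs s u = q s u / p s u + \<beta> * (\<Sum>s'\<in>\<S>. r s u s' / p s u * (MIN u'\<in>U. Qs s' u'))"
  proof (rule bellman_fixed_point_exists[OF finU U_ne \<beta> finS,
        where w = "\<lambda>s u s'. r s u s' / p s u" and C = "\<lambda>s u. q s u / p s u"])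
    show "0 \<le> r s u s' / p s u" if "s \<in> \<S>" "u \<in> U" "s' \<in> \<S>" for s u s'
      using r_nonneg[OF that] p_pos[OF that(1,2)] by simp
    show "(\<Sum>s'\<in>\<S>. r s u s' / p s u) = 1" if "s \<in> \<S>" "u \<in> U" for s u
      using r_sum[OF that] p_pos[OF that] by (simp flip: sum_divide_distrib)
  qed (rule that)
  define V where "V s = (MIN u\<in>U. Qs s u)" for s
  define Vt where "Vt t s = (MIN u\<in>U. q_iter \<beta> U a S C Q0 t s u)" for t s
  have Qs_p: "q s u + \<beta> * (\<Sum>s'\<in>\<S>. r s u s' * V s') = p s u * Qs s u" if "s \<in> \<S>" "u \<in> U" for s u
  proof -
    have "Qs s u = (q s u + \<beta> * (\<Sum>s'\<in>\<S>. r s u s' * V s')) / p s u"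
      by (subst Qs[OF that]) (simp add: V_def add_divide_distrib flip: sum_divide_distrib)
    then show ?thesis using p_pos[OF that] by simp
  qed

  define e where "e t z = q_iter \<beta> U a S C Q0 t (fst z) (snd z) - Qs (fst z) (snd z)" for t z
  define n where "n t z = (\<Sum>k<t. v k z)" for t z
  define noise where "noise t z = (Q0 (fst z) (snd z) - Qs (fst z) (snd z)) +
    (\<Sum>k<t. v k z * (C k + \<beta> * V (S (Suc k)) - Qs (fst z) (snd z)))" for t z
  let ?Z = "\<S> \<times> U"
  have n_nonneg: "0 \<le> n t z" for t z
    unfolding n_def v_def by (intro sum_nonneg) auto
  have n_lim: "(\<lambda>t. n t z / real t) \<longlonglongrightarrow> p (fst z) (snd z)" if "z \<in> ?Z" for z
    unfolding n_def v_def using that by (intro visits) auto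

  have noise_lim: "(\<lambda>t. noise t z / (1 + n t z)) \<longlonglongrightarrow> 0" if z: "z \<in> ?Z" for z
  proof -
    obtain s u where z_eq: "z = (s, u)" and su: "s \<in> \<S>" "u \<in> U" using z by auto
    \<comment> \<open>Sorting the visits by the next state expresses the average of \<open>V\<close> by transition frequencies.\<close>
    have V_sum: "V (S (Suc k)) = (\<Sum>s'\<in>\<S>. of_bool (S (Suc k) = s') * V s')" for k
    proof -
      have "(\<Sum>s'\<in>\<S>. of_bool (S (Suc k) = s') * V s') = (\<Sum>s'\<in>\<S>. if S (Suc k) = s' then V s' else 0)"
        by (intro sum.cong) auto
      then show ?thesis using sum.delta'[OF finS, of "S (Suc k)" V] S by simp
    qed
    define m where "m t s' = (\<Sum>k<t. v k z * of_bool (S (Suc k) = s'))" for t s'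
    have split: "noise t z / real t = (Q0 s u - Qs s u) / real t
        + ((\<Sum>k<t. v k z * C k) / real t + \<beta> * (\<Sum>s'\<in>\<S>. m t s' / real t * V s')
           - n t z / real t * Qs s u)" for t
    proof -
      have "(\<Sum>k<t. v k z * V (S (Suc k))) = (\<Sum>s'\<in>\<S>. m t s' * V s')"
        unfolding V_sum m_def sum_distrib_left sum_distrib_right by (subst sum.swap) (simp add: mult.assoc)
      then have "(\<Sum>k<t. v k z * (C k + \<beta> * V (S (Suc k)) - Qs s u))
          = (\<Sum>k<t. v k z * C k) + \<beta> * (\<Sum>s'\<in>\<S>. m t s' * V s') - n t z * Qs s u"
        unfolding n_def
        by (simp add: algebra_simps sum.distrib sum_subtractf flip: sum_distrib_left sum_distrib_right)
      moreover have "(\<Sum>s'\<in>\<S>. m t s' / real t * V s') = (\<Sum>s'\<in>\<S>. m t s' * V s') / real t"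
        by (simp add: sum_divide_distrib)
      ultimately show ?thesis
        unfolding noise_def by (simp add: z_eq add_divide_distrib diff_divide_distrib)
    qed
    have "(\<lambda>t. noise t z / real t) \<longlonglongrightarrow>
        0 + (q s u + \<beta> * (\<Sum>s'\<in>\<S>. r s u s' * V s') - p s u * Qs s u)"
      unfolding split
      using n_lim[OF z] costs[OF su] transitions[OF su]
      by (intro tendsto_intros lim_const_over_n) (auto simp: v_def m_def z_eq)
    then have numerator: "(\<lambda>t. noise t z / real t) \<longlonglongrightarrow> 0"
      using Qs_p[OF su] by simp
    \<comment> \<open>Averages over time become averages over visits, since the visits have positive frequency.\<close>
    have "(\<lambda>t. 1 / real t + n t z / real t) \<longlonglongrightarrow> 0 + p s u"
      using n_lim[OF z] by (intro tendsto_add lim_const_over_n) (auto simp: z_eq)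
    then have "(\<lambda>t. (noise t z / real t) / (1 / real t + n t z / real t)) \<longlonglongrightarrow> 0 / p s u"
      using p_pos[OF su] by (intro tendsto_divide numerator) auto
    then have "(\<lambda>t. (noise t z / real t) / (1 / real t + n t z / real t)) \<longlonglongrightarrow> 0"
      by simp
    moreover have "\<forall>\<^sub>F t in sequentially.
        (noise t z / real t) / (1 / real t + n t z / real t) = noise t z / (1 + n t z)"
      using eventually_gt_at_top[of 0]
      by eventually_elim (subst add_divide_distrib[symmetric], simp)
    ultimately show ?thesis
      by (rule Lim_transform_eventually)
  qed

  have "(\<lambda>t. e t (s, u)) \<longlonglongrightarrow> 0"
  proof (rule discounted_average_errors_tendsto_zero[where Z = ?Z and v = v and \<beta> = \<beta> and \<rho> = "\<lambda>t z. \<bar>noise t z / (1 + n t z)\<bar>"])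
    show "filterlim (\<lambda>t. \<Sum>k<t. v k z) at_top sequentially" if z: "z \<in> ?Z" for z
    proof -
      have "filterlim (\<lambda>t. n t z / real t * real t) at_top sequentially"
        using p_pos z
        by (intro filterlim_tendsto_pos_mult_at_top[OF n_lim[OF z]] filterlim_real_sequentially) auto
      moreover have "\<forall>\<^sub>F t in sequentially. n t z / real t * real t = (\<Sum>k<t. v k z)"
        using eventually_gt_at_top[of 0] by eventually_elim (simp add: n_def)
      ultimately show ?thesis by (simp cong: filterlim_cong)
    qed
    show "(\<lambda>t. \<bar>noise t z / (1 + n t z)\<bar>) \<longlonglongrightarrow> 0" if "z \<in> ?Z" for z
      using tendsto_rabs[OF noise_lim[OF that]] by simp
    show "\<bar>e t z\<bar> \<le> \<bar>noise t z / (1 + n t z)\<bar> +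
        \<beta> * (\<Sum>k<t. v k z * (MAX z\<in>?Z. \<bar>e k z\<bar>)) / (1 + (\<Sum>k<t. v k z))" if z: "z \<in> ?Z" for t z
    proof -
      obtain s u where z_eq: "z = (s, u)" and su: "s \<in> \<S>" "u \<in> U" using z by auto
      define D where "D = (\<Sum>k<t. v k z * (Vt k (S (Suc k)) - V (S (Suc k))))"
      have "(1 + n t z) * q_iter \<beta> U a S C Q0 t s u = Q0 s u + (\<Sum>k<t. v k z * (C k + \<beta> * Vt k (S (Suc k))))"
        unfolding n_def v_def Vt_def z_eq fst_conv snd_conv by (rule q_iter_eq_average) (rule a[OF su])
      then have "(1 + n t z) * e t z = noise t z + \<beta> * D"
        unfolding n_def D_def e_def noise_def
        by (simp add: z_eq algebra_simps sum.distrib sum_subtractf sum_distrib_left)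
      then have "e t z = noise t z / (1 + n t z) + \<beta> * D / (1 + n t z)"
        using n_nonneg[of t z] by (simp add: eq_divide_eq mult.commute flip: add_divide_distrib)
      moreover have "\<bar>D\<bar> \<le> (\<Sum>k<t. v k z * (MAX z\<in>?Z. \<bar>e k z\<bar>))"
        unfolding D_def
      proof (intro order_trans[OF sum_abs] sum_mono)
        fix k
        have "\<bar>q_iter \<beta> U a S C Q0 k (S (Suc k)) u' - Qs (S (Suc k)) u'\<bar> \<le> (MAX z\<in>?Z. \<bar>e k z\<bar>)" if "u' \<in> U" for u'
          using finS finU S that by (intro Max_ge image_eqI[where x = "(S (Suc k), u')"]) (auto simp: e_def)
        then have "\<bar>Vt k (S (Suc k)) - V (S (Suc k))\<bar> \<le> (MAX z\<in>?Z. \<bar>e k z\<bar>)"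
          unfolding Vt_def V_def by (intro abs_MIN_diff_le finU U_ne)
        then show "\<bar>v k z * (Vt k (S (Suc k)) - V (S (Suc k)))\<bar> \<le> v k z * (MAX z\<in>?Z. \<bar>e k z\<bar>)"
          by (auto simp: v_def abs_mult)
      qed
      then have "\<bar>\<beta> * D / (1 + n t z)\<bar> \<le> \<beta> * (\<Sum>k<t. v k z * (MAX z\<in>?Z. \<bar>e k z\<bar>)) / (1 + n t z)"
        using \<beta> n_nonneg[of t z] by (auto simp: abs_mult intro!: divide_right_mono mult_left_mono)
      ultimately show ?thesis unfolding n_def by linarith
    qed
  qed (use finS finU \<beta> su in \<open>auto simp: v_def\<close>)
  then have "(\<lambda>t. e t (s, u) + Qs s u) \<longlonglongrightarrow> 0 + Qs s u"
    by (intro tendsto_intros)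
  then show ?thesis
    by (auto simp: e_def intro: convergentI)
qed

section \<open>A strong law for bounded orthogonal variables\<close>

text \<open>Between \<open>n\<^sup>2\<close> and \<open>(n + 1)\<^sup>2\<close> there are only \<open>2 n\<close> further terms, which bounded increments
  cannot turn into more than \<open>2 K n\<close>, a vanishing fraction of \<open>n\<^sup>2\<close>.\<close>

lemma averages_tendsto_zero_from_squares:
  fixes x :: "nat \<Rightarrow> real"
  assumes bound: "\<And>k. \<bar>x k\<bar> \<le> K"
    and squares: "(\<lambda>n. (\<Sum>k<n\<^sup>2. x k) / real (n\<^sup>2)) \<longlonglongrightarrow> 0"
  shows "(\<lambda>N. (\<Sum>k<N. x k) / real N) \<longlonglongrightarrow> 0"
proof -
  define Y where "Y n = (\<Sum>k<n\<^sup>2. x k) / real (n\<^sup>2)" for n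
  have sqrt_lim: "filterlim floor_sqrt at_top sequentially"
    unfolding filterlim_at_top eventually_sequentially
    by (metis floor_sqrt_inverse_power2 mono_floor_sqrt')
  have "(\<lambda>n. \<bar>Y n\<bar> + 2 * K / real n) \<longlonglongrightarrow> 0 + 0"
    using squares unfolding Y_def by (intro tendsto_add tendsto_rabs_zero lim_const_over_n)
  then have lim: "(\<lambda>N. \<bar>Y (floor_sqrt N)\<bar> + 2 * K / real (floor_sqrt N)) \<longlonglongrightarrow> 0"
    using filterlim_compose[OF _ sqrt_lim] by simp
  show ?thesis
  proof (rule Lim_null_comparison[OF _ lim])
    show "\<forall>\<^sub>F N in sequentially. norm ((\<Sum>k<N. x k) / real N)
        \<le> \<bar>Y (floor_sqrt N)\<bar> + 2 * K / real (floor_sqrt N)"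
      using eventually_gt_at_top[of 0]
    proof eventually_elim
      case (elim N)
      define n where "n = floor_sqrt N"
      have n: "0 < n" "n\<^sup>2 \<le> N" "N < (Suc n)\<^sup>2"
        using elim Suc_floor_sqrt_power2_gt[of N] by (auto simp: n_def)
      have K: "0 \<le> K" using bound[of 0] by linarith
      have "(\<Sum>k<N. x k) = (\<Sum>k<n\<^sup>2. x k) + (\<Sum>k=n\<^sup>2..<N. x k)"
        using n by (simp add: lessThan_atLeast0 sum.atLeastLessThan_concat)
      moreover have "\<bar>\<Sum>k=n\<^sup>2..<N. x k\<bar> \<le> (\<Sum>k=n\<^sup>2..<N. K)"
        by (intro order_trans[OF sum_abs] sum_mono bound)
      moreover have "(\<Sum>k=n\<^sup>2..<N. K) \<le> 2 * real n * K"
      proof -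
        have "N - n\<^sup>2 \<le> 2 * n" using n by (simp add: power2_eq_square)
        then have "real (N - n\<^sup>2) \<le> 2 * real n" by linarith
        then show ?thesis using K by (simp add: mult_right_mono)
      qed
      ultimately have "\<bar>\<Sum>k<N. x k\<bar> \<le> \<bar>\<Sum>k<n\<^sup>2. x k\<bar> + 2 * real n * K" by linarith
      then have "\<bar>\<Sum>k<N. x k\<bar> / real N \<le> (\<bar>\<Sum>k<n\<^sup>2. x k\<bar> + 2 * real n * K) / real (n\<^sup>2)"
        using n K by (intro frac_le) (auto simp del: of_nat_power)
      also have "\<dots> = \<bar>Y n\<bar> + 2 * K / real n"
        using n by (simp add: Y_def add_divide_distrib power2_eq_square)
      finally show ?case by (simp add: n_def)
    qed
  qed
qed

text \<open>By orthogonality the second moment of the sum of \<open>n\<close> terms is at most \<open>n K\<^sup>2\<close>, so that of the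
  average is at most \<open>K\<^sup>2 / n\<close>. This is summable along the squares, which forces almost sure
  convergence there; boundedness fills the gaps.\<close>

lemma (in prob_space) bounded_orthogonal_strong_law:
  fixes D :: "nat \<Rightarrow> 'a \<Rightarrow> real"
  assumes [measurable]: "\<And>k. D k \<in> borel_measurable M"
    and bound: "\<And>k \<omega>. \<omega> \<in> space M \<Longrightarrow> \<bar>D k \<omega>\<bar> \<le> K"
    and orthogonal: "\<And>j k. j < k \<Longrightarrow> expectation (\<lambda>\<omega>. D j \<omega> * D k \<omega>) = 0"
  shows "AE \<omega> in M. (\<lambda>N. (\<Sum>k<N. D k \<omega>) / real N) \<longlonglongrightarrow> 0"
proof -
  have K: "0 \<le> K"
    using bound not_empty by (meson abs_ge_zero all_not_in_conv order_trans)
  have integrable_prod: "integrable M (\<lambda>\<omega>. D j \<omega> * D k \<omega>)" for j k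
    using bound K
    by (intro integrable_const_bound[of _ "K * K"]) (auto simp: abs_mult intro!: AE_I2 mult_mono)
  have integrable_square: "integrable M (\<lambda>\<omega>. (\<Sum>k<n. D k \<omega>)\<^sup>2)" for n
    by (simp add: power2_eq_square sum_product integrable_prod)
  have second_moment: "expectation (\<lambda>\<omega>. (\<Sum>k<n. D k \<omega>)\<^sup>2) \<le> real n * K\<^sup>2" for n
  proof (induction n)
    case (Suc n)
    have "expectation (\<lambda>\<omega>. (\<Sum>k<Suc n. D k \<omega>)\<^sup>2)
        = expectation (\<lambda>\<omega>. (\<Sum>k<n. D k \<omega>)\<^sup>2 + (2 * (\<Sum>j<n. D j \<omega> * D n \<omega>) + D n \<omega> * D n \<omega>))"
      by (simp add: power2_eq_square sum_distrib_left sum_distrib_right algebra_simps)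
    also have "\<dots> = expectation (\<lambda>\<omega>. (\<Sum>k<n. D k \<omega>)\<^sup>2) + expectation (\<lambda>\<omega>. D n \<omega> * D n \<omega>)"
      using integrable_prod integrable_square orthogonal by simp
    also have "expectation (\<lambda>\<omega>. D n \<omega> * D n \<omega>) \<le> K\<^sup>2"
    proof (rule integral_le_const[OF integrable_prod AE_I2])
      show "D n \<omega> * D n \<omega> \<le> K\<^sup>2" if "\<omega> \<in> space M" for \<omega>
        using mult_mono[OF bound[OF that, of n] bound[OF that, of n] K] by (simp add: power2_eq_square)
    qed
    finally show ?case using Suc by (simp add: algebra_simps)
  qed simp
  define Y where "Y n \<omega> = (\<Sum>k<n\<^sup>2. D k \<omega>) / real (n\<^sup>2)" for n \<omega>
  have [measurable]: "Y n \<in> borel_measurable M" for n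
    unfolding Y_def by measurable
  have Y_moment: "(\<integral>\<^sup>+ \<omega>. ennreal ((Y n \<omega>)\<^sup>2) \<partial>M) \<le> ennreal (K\<^sup>2 * (1 / real n ^ 2))" for n
  proof -
    have eq: "(Y n \<omega>)\<^sup>2 = (\<Sum>k<n\<^sup>2. D k \<omega>)\<^sup>2 / (real (n\<^sup>2))\<^sup>2" for \<omega>
      by (simp add: Y_def power_divide)
    have "(\<integral>\<^sup>+ \<omega>. ennreal ((Y n \<omega>)\<^sup>2) \<partial>M) = ennreal (expectation (\<lambda>\<omega>. (Y n \<omega>)\<^sup>2))"
      unfolding eq using integrable_square by (intro nn_integral_eq_integral) auto
    also have "expectation (\<lambda>\<omega>. (Y n \<omega>)\<^sup>2) \<le> (real (n\<^sup>2) * K\<^sup>2) / (real (n\<^sup>2))\<^sup>2"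
      unfolding eq using second_moment[of "n\<^sup>2"] by (simp add: divide_right_mono)
    also have "\<dots> = K\<^sup>2 * (1 / real n ^ 2)"
      by (simp add: power2_eq_square)
    finally show ?thesis by (simp add: ennreal_leI)
  qed
  have "(\<integral>\<^sup>+ \<omega>. (\<Sum>n. ennreal ((Y n \<omega>)\<^sup>2)) \<partial>M) = (\<Sum>n. \<integral>\<^sup>+ \<omega>. ennreal ((Y n \<omega>)\<^sup>2) \<partial>M)"
    by (intro nn_integral_suminf) measurable
  also have "\<dots> \<le> (\<Sum>n. ennreal (K\<^sup>2 * (1 / real n ^ 2)))"
    by (intro suminf_le Y_moment) auto
  also have "\<dots> < \<infinity>"
    using summable_mult[OF inverse_power_summable[of 2, where 'a = real], of "K\<^sup>2"]
    by (subst suminf_ennreal2) (auto simp: field_simps)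
  finally have "AE \<omega> in M. (\<Sum>n. ennreal ((Y n \<omega>)\<^sup>2)) \<noteq> \<infinity>"
    by (intro nn_integral_PInf_AE) auto
  then show ?thesis
    using AE_space
  proof eventually_elim
    case (elim \<omega>)
    then have "summable (\<lambda>n. (Y n \<omega>)\<^sup>2)"
      by (intro summable_suminf_not_top) auto
    then have "(\<lambda>n. (Y n \<omega>)\<^sup>2) \<longlonglongrightarrow> 0"
      by (rule summable_LIMSEQ_zero)
    then have "(\<lambda>n. Y n \<omega>) \<longlonglongrightarrow> 0"
      using tendsto_null_power by simp
    then show ?case
      using bound elim unfolding Y_def by (intro averages_tendsto_zero_from_squares) auto
  qed
qed

section \<open>Empirical transition frequencies of a controlled Markov chain\<close>

lemma history_measurable:
  assumes [measurable]: "\<And>k. X k \<in> P \<rightarrow>\<^sub>M MX" "\<And>k. U k \<in> P \<rightarrow>\<^sub>M MU"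
  shows "history X U m n \<in> P \<rightarrow>\<^sub>M history_space MX MU m n"
  unfolding history_def[abs_def] history_space_def by measurable

lemma history_algebra_coordinates_measurable:
  assumes X: "\<And>k. X k \<in> P \<rightarrow>\<^sub>M MX" and U: "\<And>k. U k \<in> P \<rightarrow>\<^sub>M MU"
  shows "k < m \<Longrightarrow> X k \<in> history_algebra P MX MU X U m n \<rightarrow>\<^sub>M MX"
    and "k < n \<Longrightarrow> U k \<in> history_algebra P MX MU X U m n \<rightarrow>\<^sub>M MU"
proof -
  have h: "history X U m n \<in> history_algebra P MX MU X U m n \<rightarrow>\<^sub>M
      PiM {..<m} (\<lambda>_. MX) \<Otimes>\<^sub>M PiM {..<n} (\<lambda>_. MU)"
    unfolding history_algebra_def history_space_def[symmetric]
    by (intro measurable_vimage_algebra1) (auto dest: measurable_space[OF history_measurable[OF assms]])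
  show "X k \<in> history_algebra P MX MU X U m n \<rightarrow>\<^sub>M MX" if "k < m"
    using measurable_compose[OF measurable_compose[OF h measurable_fst] measurable_component_singleton[of k "{..<m}"]]
      that by (simp add: history_def)
  show "U k \<in> history_algebra P MX MU X U m n \<rightarrow>\<^sub>M MU" if "k < n"
    using measurable_compose[OF measurable_compose[OF h measurable_snd] measurable_component_singleton[of k "{..<n}"]]
      that by (simp add: history_def)
qed

lemma measure_prob_kernel_le_1:
  assumes "\<T> \<in> N \<rightarrow>\<^sub>M prob_algebra L" and "z \<in> space N"
  shows "measure (\<T> z) A \<le> 1"
  using measurable_space[OF assms] by (auto simp: space_prob_algebra intro: prob_space.prob_le_1)

lemma controlled_markov_chain_kernel_le_1:
  assumes chain: "controlled_markov_chain P MX MU \<T> \<gamma> X U" and \<omega>: "\<omega> \<in> space P"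
  shows "measure (\<T> (X t \<omega>, U t \<omega>)) G \<le> 1"
proof (rule measure_prob_kernel_le_1[where N = "MX \<Otimes>\<^sub>M MU" and L = MX])
  show "\<T> \<in> MX \<Otimes>\<^sub>M MU \<rightarrow>\<^sub>M prob_algebra MX"
    using chain by (simp add: controlled_markov_chain_def)
  show "(X t \<omega>, U t \<omega>) \<in> space (MX \<Otimes>\<^sub>M MU)"
    using chain \<omega> by (auto simp: controlled_markov_chain_def space_pair_measure intro: measurable_space)
qed

text \<open>The kernel is the conditional probability of the next state given the history, and a factor
  depending on the history can be moved inside the conditional expectation.\<close>

lemma controlled_markov_chain_transition_integral:
  fixes f :: "'w \<Rightarrow> real"
  assumes chain: "controlled_markov_chain P MX MU \<T> \<gamma> X U"
    and G: "G \<in> sets MX"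
    and f: "f \<in> borel_measurable (history_algebra P MX MU X U (Suc t) (Suc t))"
    and f_bound: "\<And>\<omega>. \<omega> \<in> space P \<Longrightarrow> \<bar>f \<omega>\<bar> \<le> K"
  shows "(\<integral>\<omega>. f \<omega> * (indicator G (X (Suc t) \<omega>) - measure (\<T> (X t \<omega>, U t \<omega>)) G) \<partial>P) = 0"
proof -
  interpret prob_space P using chain by (simp add: controlled_markov_chain_def)
  have [measurable]: "X k \<in> P \<rightarrow>\<^sub>M MX" "U k \<in> P \<rightarrow>\<^sub>M MU" for k
    using chain by (auto simp: controlled_markov_chain_def)
  have [measurable]: "\<T> \<in> MX \<Otimes>\<^sub>M MU \<rightarrow>\<^sub>M prob_algebra MX" and [measurable]: "G \<in> sets MX"
    using chain G by (auto simp: controlled_markov_chain_def)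
  define F where "F = history_algebra P MX MU X U (Suc t) (Suc t)"
  have "history X U (Suc t) (Suc t) \<in> P \<rightarrow>\<^sub>M history_space MX MU (Suc t) (Suc t)"
    by (rule history_measurable) measurable
  then have "subalgebra P F"
    unfolding subalgebra_def F_def history_algebra_def
    by (subst sets_vimage_algebra2) (auto dest: measurable_sets measurable_space)
  then interpret finite_measure_subalgebra P F
    by unfold_locales
  let ?g = "indicator (X (Suc t) -` G \<inter> space P) :: 'w \<Rightarrow> real"
  have f_P: "f \<in> borel_measurable P"
    using measurable_from_subalg[OF subalg] f unfolding F_def by blast
  note kernel_le = controlled_markov_chain_kernel_le_1[OF chain]
  have K: "0 \<le> K"
    using f_bound not_empty by (meson abs_ge_zero all_not_in_conv order_trans)
  have int_g: "integrable P (\<lambda>\<omega>. f \<omega> * ?g \<omega>)"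
    using f_bound f_P K by (intro integrable_const_bound[of _ K]) (auto simp: indicator_def intro!: AE_I2)
  have int_T: "integrable P (\<lambda>\<omega>. f \<omega> * measure (\<T> (X t \<omega>, U t \<omega>)) G)"
  proof (rule integrable_const_bound[of _ "K * 1"])
    show "AE \<omega> in P. norm (f \<omega> * measure (\<T> (X t \<omega>, U t \<omega>)) G) \<le> K * 1"
      unfolding norm_mult using f_bound kernel_le K
      by (intro AE_I2 mult_mono) auto
  qed (use f_P in measurable)
  have ce: "AE \<omega> in P. real_cond_exp P F ?g \<omega> = measure (\<T> (X t \<omega>, U t \<omega>)) G"
    using chain G unfolding controlled_markov_chain_def F_def by blast
  have "(\<integral>\<omega>. f \<omega> * (indicator G (X (Suc t) \<omega>) - measure (\<T> (X t \<omega>, U t \<omega>)) G) \<partial>P)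
      = (\<integral>\<omega>. f \<omega> * ?g \<omega> - f \<omega> * measure (\<T> (X t \<omega>, U t \<omega>)) G \<partial>P)"
    by (intro Bochner_Integration.integral_cong) (auto simp: indicator_def right_diff_distrib)
  also have "\<dots> = (\<integral>\<omega>. f \<omega> * ?g \<omega> \<partial>P) - (\<integral>\<omega>. f \<omega> * measure (\<T> (X t \<omega>, U t \<omega>)) G \<partial>P)"
    by (intro Bochner_Integration.integral_diff int_g int_T)
  also have "(\<integral>\<omega>. f \<omega> * ?g \<omega> \<partial>P) = (\<integral>\<omega>. f \<omega> * real_cond_exp P F ?g \<omega> \<partial>P)"
    using real_cond_exp_intg(2)[OF int_g] f by (simp add: F_def)
  also have "\<dots> = (\<integral>\<omega>. f \<omega> * measure (\<T> (X t \<omega>, U t \<omega>)) G \<partial>P)"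
  proof (rule integral_cong_AE)
    show "AE \<omega> in P. f \<omega> * real_cond_exp P F ?g \<omega> = f \<omega> * measure (\<T> (X t \<omega>, U t \<omega>)) G"
      using ce by eventually_elim simp
  qed (use f_P in measurable)
  finally show ?thesis by simp
qed

text \<open>The summands are orthogonal: the earlier one depends only on the history up to the later time
  \<open>k\<close>, including \<open>X\<^sub>j\<^sub>+\<^sub>1\<close> because \<open>j + 1 \<le> k\<close>, and the centred indicator at time \<open>k\<close>
  integrates to zero against every bounded function of that history.\<close>

lemma controlled_markov_chain_transition_averages:
  assumes chain: "controlled_markov_chain P MX MU \<T> \<gamma> X U"
    and G: "G \<in> sets MX" and H: "H \<in> sets (MX \<Otimes>\<^sub>M MU)"
  shows "AE \<omega> in P. (\<lambda>N. (\<Sum>k<N. indicator H (X k \<omega>, U k \<omega>) *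
      (indicator G (X (Suc k) \<omega>) - measure (\<T> (X k \<omega>, U k \<omega>)) G)) / real N) \<longlonglongrightarrow> (0 :: real)"
proof -
  interpret prob_space P using chain by (simp add: controlled_markov_chain_def)
  have X [measurable]: "X k \<in> P \<rightarrow>\<^sub>M MX" and U [measurable]: "U k \<in> P \<rightarrow>\<^sub>M MU" for k
    using chain by (auto simp: controlled_markov_chain_def)
  have T [measurable]: "\<T> \<in> MX \<Otimes>\<^sub>M MU \<rightarrow>\<^sub>M prob_algebra MX"
    using chain by (auto simp: controlled_markov_chain_def)
  note [measurable] = G H
  define D :: "nat \<Rightarrow> 'a \<Rightarrow> real" where "D k \<omega> = indicator H (X k \<omega>, U k \<omega>) *
      (indicator G (X (Suc k) \<omega>) - measure (\<T> (X k \<omega>, U k \<omega>)) G)" for k \<omega>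
  have D_bound: "\<bar>D k \<omega>\<bar> \<le> 1" if "\<omega> \<in> space P" for k \<omega>
    using controlled_markov_chain_kernel_le_1[OF chain that, of k G] by (auto simp: D_def indicator_def)
  have "AE \<omega> in P. (\<lambda>N. (\<Sum>k<N. D k \<omega>) / real N) \<longlonglongrightarrow> 0"
  proof (rule bounded_orthogonal_strong_law[OF _ D_bound])
    show "D k \<in> borel_measurable P" for k
      unfolding D_def by measurable
    fix j k :: nat assume "j < k"
    let ?F = "history_algebra P MX MU X U (Suc k) (Suc k)"
    have [measurable]: "X j \<in> ?F \<rightarrow>\<^sub>M MX" "X (Suc j) \<in> ?F \<rightarrow>\<^sub>M MX" "U j \<in> ?F \<rightarrow>\<^sub>M MU"
        "X k \<in> ?F \<rightarrow>\<^sub>M MX" "U k \<in> ?F \<rightarrow>\<^sub>M MU"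
      using \<open>j < k\<close> by (auto intro!: history_algebra_coordinates_measurable X U)
    have "(\<integral>\<omega>. (D j \<omega> * indicator H (X k \<omega>, U k \<omega>)) *
        (indicator G (X (Suc k) \<omega>) - measure (\<T> (X k \<omega>, U k \<omega>)) G) \<partial>P) = 0"
    proof (rule controlled_markov_chain_transition_integral[OF chain G])
      show "(\<lambda>\<omega>. D j \<omega> * indicator H (X k \<omega>, U k \<omega>)) \<in> borel_measurable ?F"
        unfolding D_def by measurable
      show "\<bar>D j \<omega> * indicator H (X k \<omega>, U k \<omega>)\<bar> \<le> 1" if "\<omega> \<in> space P" for \<omega>
        using D_bound[OF that, of j] by (auto simp: indicator_def)
    qed
    then show "expectation (\<lambda>\<omega>. D j \<omega> * D k \<omega>) = 0"
      by (simp add: D_def[of k] mult.assoc)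
  qed auto
  then show ?thesis by (simp add: D_def)
qed

section \<open>Almost sure convergence of quantized Q-learning\<close>

theorem corollary3p2:
  fixes \<X> :: "'x::polish_space set" and \<U> :: "'u set"
    and P :: "'w measure"
    and \<T> :: "'x \<times> 'u \<Rightarrow> 'x measure"
    and \<gamma> :: "nat \<Rightarrow> (nat \<Rightarrow> 'x) \<times> (nat \<Rightarrow> 'u) \<Rightarrow> 'u measure"
    and X :: "nat \<Rightarrow> 'w \<Rightarrow> 'x" and U :: "nat \<Rightarrow> 'w \<Rightarrow> 'u"
    and c :: "'x \<times> 'u \<Rightarrow> real" and \<beta> :: real
    and M :: nat and B :: "nat \<Rightarrow> 'x set" and y :: "nat \<Rightarrow> 's" and g :: "'x \<Rightarrow> 's"
    and \<pi> :: "('x \<times> 'u) measure"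
    and \<alpha> :: "'w \<Rightarrow> nat \<Rightarrow> 's \<Rightarrow> 'u \<Rightarrow> real"
    and Q\<^sub>0 :: "'s \<Rightarrow> 'u \<Rightarrow> real"
  defines "MX \<equiv> restrict_space borel \<X>" and "MU \<equiv> count_space \<U>"
  assumes X_compact: "compact \<X>"
    and U_finite: "finite \<U>"
    and beta: "0 < \<beta>" "\<beta> < 1"
    and chain: "controlled_markov_chain P MX MU \<T> \<gamma> X U"
    and c_nonneg: "\<And>x u. x \<in> \<X> \<Longrightarrow> u \<in> \<U> \<Longrightarrow> 0 \<le> c (x, u)"
    and c_continuous:
      "continuous_map (prod_topology (top_of_set \<X>) (discrete_topology \<U>)) euclideanreal c"
    and c_bounded: "bounded (c ` (\<X> \<times> \<U>))"
    and B_measurable: "\<And>i. i \<in> {1..M} \<Longrightarrow> B i \<in> sets MX"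
    and B_disjoint: "disjoint_family_on B {1..M}"
    and B_cover: "(\<Union>i\<in>{1..M}. B i) = \<X>"
    and quantizer: "\<And>i x. i \<in> {1..M} \<Longrightarrow> x \<in> B i \<Longrightarrow> g x = y i"
    and pi_prob: "prob_space \<pi>" and pi_sets: "sets \<pi> = sets (MX \<Otimes>\<^sub>M MU)"
    and ergodic: "\<And>f :: 'x \<times> 'u \<Rightarrow> real. integrable \<pi> f \<Longrightarrow>
      AE \<omega> in P. (\<lambda>N. (1 / real N) * (\<Sum>t<N. f (X t \<omega>, U t \<omega>)))
        \<longlonglongrightarrow> (\<integral>z. f z \<partial>\<pi>)"
    and pi_pos: "\<And>i u. i \<in> {1..M} \<Longrightarrow> u \<in> \<U> \<Longrightarrow> measure \<pi> (B i \<times> {u}) > 0"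
    and alpha_off: "\<And>\<omega> t s u. \<omega> \<in> space P \<Longrightarrow> s \<in> y ` {1..M} \<Longrightarrow> u \<in> \<U> \<Longrightarrow>
      (g (X t \<omega>), U t \<omega>) \<noteq> (s, u) \<Longrightarrow> \<alpha> \<omega> t s u = 0"
    and alpha_on: "\<And>\<omega> t s u. \<omega> \<in> space P \<Longrightarrow> s \<in> y ` {1..M} \<Longrightarrow> u \<in> \<U> \<Longrightarrow>
      (g (X t \<omega>), U t \<omega>) = (s, u) \<Longrightarrow>
      \<alpha> \<omega> t s u = inverse (1 + (\<Sum>k\<le>t. of_bool (g (X k \<omega>) = s \<and> U k \<omega> = u)))"
    and alpha_sum: "AE \<omega> in P. \<forall>s\<in>y ` {1..M}. \<forall>u\<in>\<U>.
      filterlim (\<lambda>N. \<Sum>t<N. \<alpha> \<omega> t s u) at_top sequentially"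
  shows "\<forall>s\<in>y ` {1..M}. \<forall>u\<in>\<U>. AE \<omega> in P.
    convergent (\<lambda>t. q_iter \<beta> \<U> (\<alpha> \<omega>) (\<lambda>k. g (X k \<omega>)) (\<lambda>k. c (X k \<omega>, U k \<omega>)) Q\<^sub>0 t s u)"
proof -
  interpret prob_space P using chain by (simp add: controlled_markov_chain_def)
  have X [measurable]: "X k \<in> P \<rightarrow>\<^sub>M MX" and U [measurable]: "U k \<in> P \<rightarrow>\<^sub>M MU" for k
    using chain by (auto simp: controlled_markov_chain_def)
  have T [measurable]: "\<T> \<in> MX \<Otimes>\<^sub>M MU \<rightarrow>\<^sub>M prob_algebra MX"
    using chain by (auto simp: controlled_markov_chain_def)
  have X_in: "X k \<omega> \<in> \<X>" if "\<omega> \<in> space P" for k \<omega>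
    using measurable_space[OF X that] by (simp add: MX_def space_restrict_space)
  have space_\<pi>: "space \<pi> = \<X> \<times> \<U>"
    using sets_eq_imp_space_eq[OF pi_sets]
    by (simp add: space_pair_measure MX_def MU_def space_restrict_space)
  interpret \<pi>: prob_space \<pi> by (rule pi_prob)

  \<comment> \<open>Several cells may carry the same label, so the level sets of \<open>g\<close> are unions of cells.\<close>
  define G where "G s = (\<Union>i\<in>{i \<in> {1..M}. y i = s}. B i)" for s
  define H where "H s u = G s \<times> {u}" for s and u :: 'u
  have G_sets [measurable]: "G s \<in> sets MX" for s
    unfolding G_def using B_measurable by (intro sets.finite_UN) auto
  have H_sets: "H s u \<in> sets (MX \<Otimes>\<^sub>M MU)" if "u \<in> \<U>" for s u
    unfolding H_def using that G_sets by (intro pair_measureI) (auto simp: MU_def)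
  have g_in: "g x \<in> y ` {1..M}" and in_G: "x \<in> G s \<longleftrightarrow> g x = s" if "x \<in> \<X>" for x s
  proof -
    have "x \<in> (\<Union>i\<in>{1..M}. B i)" using that by (simp only: B_cover)
    then obtain i where i: "i \<in> {1..M}" "x \<in> B i" by blast
    show "g x \<in> y ` {1..M}" using quantizer[OF i] i(1) by (rule image_eqI)
    show "x \<in> G s \<longleftrightarrow> g x = s"
    proof
      assume "x \<in> G s"
      then obtain j where "j \<in> {1..M}" "y j = s" "x \<in> B j" by (auto simp: G_def)
      with quantizer[of j x] show "g x = s" by simp
    next
      assume "g x = s"
      with quantizer[OF i] i show "x \<in> G s" by (auto simp: G_def)
    qed
  qed
  have in_H: "indicator (H s u) (X k \<omega>, U k \<omega>) = (of_bool (g (X k \<omega>) = s \<and> U k \<omega> = u) :: real)"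
    if "\<omega> \<in> space P" for s u k \<omega>
    using in_G[OF X_in[OF that]] by (auto simp: H_def indicator_def)
  have integrable_\<pi>: "integrable \<pi> f"
    if "f \<in> borel_measurable (MX \<Otimes>\<^sub>M MU)" "\<And>z. z \<in> \<X> \<times> \<U> \<Longrightarrow> \<bar>f z\<bar> \<le> K" for f and K :: real
    using that measurable_cong_sets[OF pi_sets refl, of borel]
    by (intro \<pi>.integrable_const_bound[of _ K]) (auto simp: space_\<pi> intro!: AE_I2)

  have c_measurable: "c \<in> borel_measurable (MX \<Otimes>\<^sub>M MU)"
  proof -
    have "(\<lambda>x. c (x, u)) \<in> borel_measurable MX" if "u \<in> \<U>" for u
    proof -
      have "continuous_map (top_of_set \<X>) (prod_topology (top_of_set \<X>) (discrete_topology \<U>)) (\<lambda>x. (x, u))"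
        using that by (simp add: continuous_map_pairedI)
      from continuous_map_compose[OF this c_continuous] show ?thesis
        unfolding MX_def by (intro borel_measurable_continuous_on_restrict) (simp add: o_def)
    qed
    then have "(\<lambda>z. c (snd z, fst z)) \<in> borel_measurable (MU \<Otimes>\<^sub>M MX)"
      unfolding MU_def by (intro measurable_pair_measure_countable1) (auto simp: U_finite countable_finite)
    from measurable_compose[OF measurable_pair_swap' this] show ?thesis
      by (simp add: case_prod_beta)
  qed
  obtain K where K: "\<And>z. z \<in> \<X> \<times> \<U> \<Longrightarrow> \<bar>c z\<bar> \<le> K"
    using c_bounded by (auto simp: bounded_iff)

  define p :: "'s \<Rightarrow> 'u \<Rightarrow> real" where "p s u = (\<integral>z. indicator (H s u) z \<partial>\<pi>)" for s u
  define q where "q s u = (\<integral>z. indicator (H s u) z * c z \<partial>\<pi>)" for s u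
  define r where "r s u s' = (\<integral>z. indicator (H s u) z * measure (\<T> z) (G s') \<partial>\<pi>)" for s u s'
  have kernel_le_1: "measure (\<T> z) A \<le> 1" if "z \<in> \<X> \<times> \<U>" for z A
    using that by (intro measure_prob_kernel_le_1[OF T])
      (auto simp: space_pair_measure MX_def MU_def space_restrict_space)
  have p_pos: "0 < p s u" if su: "s \<in> y ` {1..M}" "u \<in> \<U>" for s u
  proof -
    obtain i where i: "i \<in> {1..M}" "y i = s" using su by auto
    have "0 < measure \<pi> (B i \<times> {u})" by (rule pi_pos[OF i(1) su(2)])
    also have "\<dots> \<le> measure \<pi> (H s u)"
      using i H_sets[OF su(2)] by (intro \<pi>.finite_measure_mono) (auto simp: H_def G_def pi_sets)
    also have "\<dots> = p s u"
      using sets.sets_into_space[OF H_sets[OF su(2), folded pi_sets]]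
      by (simp add: p_def Int_absorb2)
    finally show ?thesis .
  qed

  have visits: "AE \<omega> in P. (\<lambda>t. (\<Sum>k<t. of_bool (g (X k \<omega>) = s \<and> U k \<omega> = u)) / real t) \<longlonglongrightarrow> p s u"
    if u: "u \<in> \<U>" for s u
  proof -
    have "integrable \<pi> (indicator (H s u) :: _ \<Rightarrow> real)"
      using H_sets[OF u] by (intro integrable_\<pi>[of _ 1]) (auto simp: indicator_def)
    from ergodic[OF this] AE_space show ?thesis
      by eventually_elim (simp add: in_H p_def del: sum_of_bool_eq)
  qed
  have costs: "AE \<omega> in P. (\<lambda>t. (\<Sum>k<t. of_bool (g (X k \<omega>) = s \<and> U k \<omega> = u) * c (X k \<omega>, U k \<omega>)) / real t)
      \<longlonglongrightarrow> q s u" if u: "u \<in> \<U>" for s u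
  proof -
    have "integrable \<pi> (\<lambda>z. indicator (H s u) z * c z)"
    proof (rule integrable_\<pi>)
      show "\<bar>indicator (H s u) z * c z\<bar> \<le> K" if "z \<in> \<X> \<times> \<U>" for z
        using K[OF that] by (auto simp: indicator_def)
    qed (use H_sets[OF u] c_measurable in measurable)
    from ergodic[OF this] AE_space show ?thesis
      by eventually_elim (simp add: in_H q_def del: sum_of_bool_mult_eq sum_mult_of_bool_eq)
  qed
  have transitions: "AE \<omega> in P. (\<lambda>t. (\<Sum>k<t. of_bool (g (X k \<omega>) = s \<and> U k \<omega> = u) *
      of_bool (g (X (Suc k) \<omega>) = s')) / real t) \<longlonglongrightarrow> r s u s'" if u: "u \<in> \<U>" for s u s'
  proof -
    have "integrable \<pi> (\<lambda>z. indicator (H s u) z * measure (\<T> z) (G s'))"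
    proof (rule integrable_\<pi>)
      show "\<bar>indicator (H s u) z * measure (\<T> z) (G s')\<bar> \<le> 1" if "z \<in> \<X> \<times> \<U>" for z
        using kernel_le_1[OF that] by (auto simp: indicator_def)
    qed (use H_sets[OF u] in measurable)
    \<comment> \<open>Ergodicity handles the conditional probabilities, the strong law the deviations from them.\<close>
    from ergodic[OF this]
      controlled_markov_chain_transition_averages[OF chain G_sets[of s'] H_sets[OF u, of s]] AE_space
    show ?thesis
    proof eventually_elim
      case (elim \<omega>)
      have "of_bool (g (X (Suc k) \<omega>) = s') = (indicator (G s') (X (Suc k) \<omega>) :: real)" for k
        using in_G[OF X_in[OF elim(3)]] by (auto simp: indicator_def)
      with tendsto_add[OF elim(1,2)] show ?case
        by (simp add: in_H[OF elim(3), symmetric] r_def right_diff_distrib sum_subtractf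
            flip: add_divide_distrib)
    qed
  qed

  have "AE \<omega> in P. \<forall>s\<in>y ` {1..M}. \<forall>u\<in>\<U>.
      convergent (\<lambda>t. q_iter \<beta> \<U> (\<alpha> \<omega>) (\<lambda>k. g (X k \<omega>)) (\<lambda>k. c (X k \<omega>, U k \<omega>)) Q\<^sub>0 t s u)"
  proof -
    have "AE \<omega> in P. \<forall>s\<in>y ` {1..M}. \<forall>u\<in>\<U>.
        (\<lambda>t. (\<Sum>k<t. of_bool (g (X k \<omega>) = s \<and> U k \<omega> = u)) / real t) \<longlonglongrightarrow> p s u"
      using visits U_finite by (simp add: AE_finite_all del: sum_of_bool_eq)
    moreover have "AE \<omega> in P. \<forall>s\<in>y ` {1..M}. \<forall>u\<in>\<U>.
        (\<lambda>t. (\<Sum>k<t. of_bool (g (X k \<omega>) = s \<and> U k \<omega> = u) * c (X k \<omega>, U k \<omega>)) / real t) \<longlonglongrightarrow> q s u"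
      using costs U_finite by (simp add: AE_finite_all del: sum_of_bool_mult_eq sum_mult_of_bool_eq)
    moreover have "AE \<omega> in P. \<forall>s\<in>y ` {1..M}. \<forall>u\<in>\<U>. \<forall>s'\<in>y ` {1..M}.
        (\<lambda>t. (\<Sum>k<t. of_bool (g (X k \<omega>) = s \<and> U k \<omega> = u) * of_bool (g (X (Suc k) \<omega>) = s')) / real t)
          \<longlonglongrightarrow> r s u s'"
      using transitions U_finite by (simp add: AE_finite_all del: sum_of_bool_mult_eq sum_mult_of_bool_eq)
    ultimately show ?thesis
      using AE_space
    proof eventually_elim
      case (elim \<omega>)
      show ?case
      proof (intro ballI q_iter_convergent[where \<S> = "y ` {1..M}" and p = p and q = q and r = r and A = "\<lambda>k. U k \<omega>"])
        show "\<alpha> \<omega> k s u = (if g (X k \<omega>) = s \<and> U k \<omega> = u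
            then inverse (1 + (\<Sum>j\<le>k. of_bool (g (X j \<omega>) = s \<and> U j \<omega> = u))) else 0)"
          if "s \<in> y ` {1..M}" "u \<in> \<U>" for s u k
          using alpha_on[OF elim(4) that, of k] alpha_off[OF elim(4) that, of k] by auto
      qed (use elim beta U_finite p_pos g_in X_in in \<open>auto simp del: sum_of_bool_eq sum_of_bool_mult_eq sum_mult_of_bool_eq\<close>)
    qed
  qed
  then show ?thesis
    using U_finite by (simp add: AE_finite_all)
qed

end
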